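(* Let $h_2$ be the second Hermite function and let $\mathcal{D}_{\sqrt2}^{-1}h_2(t)=2^{1/4}h_2(\sqrt2\,t)$. There exists a periodic structure $\Gamma\subset\mathbb{R}^2$ of density $5$ such that the Gabor system $\mathcal{G}\left(\mathcal{D}_{\sqrt2}^{-1}h_2,\Gamma\right)$ is not a frame for $L^2(\mathbb{R})$.
   Context: The $n$-th Hermite function is $h_n(t)=(-1)^nC_n e^{\pi t^2}\frac{d^n}{dt^n}\left(e^{-2\pi t^2}\right)$ with $C_n=2^{1/4}/\sqrt{n!(2\pi)^n2^n}$; in particular $h_2(t)=2^{-1/4}(-1+4\pi t^2)e^{-\pi t^2}$. The unitary dilation is $\mathcal{D}_af(t)=\frac{1}{\sqrt a}f(t/a)$, $a>0$. For $z=(x,\omega)\in\mathbb{R}^2$ the time-frequency shift is $\pi(z)f(t)=e^{2\pi i\omega t}f(t-x)$. For $\Gamma\subset\mathbb{R}^2$, the Gabor system $\mathcal{G}(g,\Gamma)=\{\pi(\gamma)g\mid\gamma\in\Gamma\}$ is a frame for $L^2(\mathbb{R})$ if there are constants $0<A\le B<\infty$ with $A\|f\|_{L^2}^2\le\sum_{\gamma\in\Gamma}|\langle f,\pi(\gamma)g\rangle|^2\le B\|f\|_{L^2}^2$ for all $f\in L^2(\mathbb{R})$. A periodic structure is a set $\Gamma=\bigcup_{m=1}^M(\Lambda+z_m)$ with $\Lambda\subset\mathbb{R}^2$ a (full-rank) lattice and $z_1,\dots,z_M\in\mathbb{R}^2$ pairwise distinct modulo $\Lambda$; its density is $M/\mathrm{vol}(\mathbb{R}^2/\Lambda)$.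 *)

theory Defs
  imports "HOL-Analysis.Analysis"
begin

definition hermite_fun :: "nat \<Rightarrow> real \<Rightarrow> complex" where
  "hermite_fun n t = complex_of_real
     ((- 1) ^ n * (2 powr (1/4) / sqrt (fact n * (2 * pi) ^ n * 2 ^ n)) * exp (pi * t\<^sup>2)
        * (deriv ^^ n) (\<lambda>s. exp (- 2 * pi * s\<^sup>2)) t)"

definition dilation :: "real \<Rightarrow> (real \<Rightarrow> complex) \<Rightarrow> real \<Rightarrow> complex" where
  "dilation a f t = complex_of_real (1 / sqrt a) * f (t / a)"

definition tf_shift :: "real \<times> real \<Rightarrow> (real \<Rightarrow> complex) \<Rightarrow> real \<Rightarrow> complex" where
  "tf_shift z f t = exp (2 * complex_of_real pi * \<i> * complex_of_real (snd z * t)) * f (t - fst z)"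

text \<open>
  Elements of \<open>L\<^sup>2(\<real>)\<close> are represented by Borel functions (every class has such a representative);
  the notions below do not depend on the representative.
\<close>

definition L2 :: "(real \<Rightarrow> complex) set" where
  "L2 = {f \<in> borel_measurable lborel. integrable lborel (\<lambda>t. (cmod (f t))\<^sup>2)}"

definition L2_inner :: "(real \<Rightarrow> complex) \<Rightarrow> (real \<Rightarrow> complex) \<Rightarrow> complex" where
  "L2_inner f g = (\<integral>t. f t * cnj (g t) \<partial>lborel)"

definition L2_norm :: "(real \<Rightarrow> complex) \<Rightarrow> real" where
  "L2_norm f = sqrt (\<integral>t. (cmod (f t))\<^sup>2 \<partial>lborel)"

text \<open>
  The sum is taken in the extended nonnegative reals, so that it always exists; the upper
  frame bound then includes its convergence.
\<close>

definition gabor_frame :: "(real \<Rightarrow> complex) \<Rightarrow> (real \<times> real) set \<Rightarrow> bool" where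
  "gabor_frame g \<Gamma> \<longleftrightarrow>
     (\<exists>A B :: real. 0 < A \<and> A \<le> B \<and>
        (\<forall>f\<in>L2.
           ennreal (A * (L2_norm f)\<^sup>2)
             \<le> (\<Sum>\<^sub>\<infinity>\<gamma>\<in>\<Gamma>. ennreal ((cmod (L2_inner f (tf_shift \<gamma> g)))\<^sup>2)) \<and>
           (\<Sum>\<^sub>\<infinity>\<gamma>\<in>\<Gamma>. ennreal ((cmod (L2_inner f (tf_shift \<gamma> g)))\<^sup>2))
             \<le> ennreal (B * (L2_norm f)\<^sup>2)))"

definition det2 :: "real \<times> real \<Rightarrow> real \<times> real \<Rightarrow> real" where
  "det2 a b = fst a * snd b - snd a * fst b"

definition int_span2 :: "real \<times> real \<Rightarrow> real \<times> real \<Rightarrow> (real \<times> real) set" where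
  "int_span2 a b = {of_int k *\<^sub>R a + of_int l *\<^sub>R b | k l. True}"

definition full_rank_lattice :: "(real \<times> real) set \<Rightarrow> bool" where
  "full_rank_lattice \<Lambda> \<longleftrightarrow> (\<exists>a b. det2 a b \<noteq> 0 \<and> \<Lambda> = int_span2 a b)"

text \<open>
  \<open>vol(\<real>\<^sup>2/\<Lambda>)\<close> is the area of a fundamental parallelogram; \<open>covolume_int_span2\<close> below shows
  that it does not depend on the basis.
\<close>

definition covolume :: "(real \<times> real) set \<Rightarrow> real" where
  "covolume \<Lambda> = (THE v. \<exists>a b. det2 a b \<noteq> 0 \<and> \<Lambda> = int_span2 a b \<and> v = \<bar>det2 a b\<bar>)"

definition periodic_structure ::
    "(real \<times> real) set \<Rightarrow> (real \<times> real) set \<Rightarrow> nat \<Rightarrow> (nat \<Rightarrow> real \<times> real) \<Rightarrow> bool" where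
  "periodic_structure \<Gamma> \<Lambda> M z \<longleftrightarrow>
     full_rank_lattice \<Lambda> \<and> 1 \<le> M \<and>
     (\<forall>m\<in>{1..M}. \<forall>n\<in>{1..M}. m \<noteq> n \<longrightarrow> z m - z n \<notin> \<Lambda>) \<and>
     \<Gamma> = (\<Union>m\<in>{1..M}. (\<lambda>v. v + z m) ` \<Lambda>)"

lemma det2_int_span2:
  assumes "c \<in> int_span2 a b" "d \<in> int_span2 a b"
  shows "\<exists>k::int. det2 c d = of_int k * det2 a b"
proof -
  obtain k l where c: "c = of_int k *\<^sub>R a + of_int l *\<^sub>R b"
    using assms(1) by (auto simp: int_span2_def)
  obtain m n where d: "d = of_int m *\<^sub>R a + of_int n *\<^sub>R b"
    using assms(2) by (auto simp: int_span2_def)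
  have "det2 c d = of_int (k * n - l * m) * det2 a b"
    by (simp add: c d det2_def algebra_simps)
  then show ?thesis by blast
qed

lemma basis_in_int_span2: "a \<in> int_span2 a b" "b \<in> int_span2 a b"
proof -
  have "a = of_int 1 *\<^sub>R a + of_int 0 *\<^sub>R b" "b = of_int 0 *\<^sub>R a + of_int 1 *\<^sub>R b" by auto
  then show "a \<in> int_span2 a b" "b \<in> int_span2 a b" unfolding int_span2_def by blast+
qed

lemma covolume_int_span2:
  assumes "det2 a b \<noteq> 0"
  shows "covolume (int_span2 a b) = \<bar>det2 a b\<bar>"
  unfolding covolume_def
proof (rule the_equality)
  show "\<exists>a' b'. det2 a' b' \<noteq> 0 \<and> int_span2 a b = int_span2 a' b' \<and> \<bar>det2 a b\<bar> = \<bar>det2 a' b'\<bar>"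
    using assms by blast
next
  fix v
  assume "\<exists>a' b'. det2 a' b' \<noteq> 0 \<and> int_span2 a b = int_span2 a' b' \<and> v = \<bar>det2 a' b'\<bar>"
  then obtain c d where cd: "det2 c d \<noteq> 0" "int_span2 a b = int_span2 c d" "v = \<bar>det2 c d\<bar>"
    by blast
  obtain k where k: "det2 c d = of_int k * det2 a b"
    using det2_int_span2 basis_in_int_span2 cd(2) by metis
  obtain l where l: "det2 a b = of_int l * det2 c d"
    using det2_int_span2 basis_in_int_span2 cd(2) by metis
  have "real_of_int (k * l) * det2 c d = det2 c d"
    by (metis k l of_int_mult mult.assoc)
  then have "real_of_int (k * l) = 1"
    using cd(1) by simp
  then have "k * l = 1" by linarith
  then have "\<bar>k\<bar> = 1" by (simp add: zmult_eq_1_iff) auto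
  then have "\<bar>real_of_int k\<bar> = 1" by (metis of_int_abs of_int_1)
  then show "v = \<bar>det2 a b\<bar>" by (simp add: cd(3) k abs_mult)
qed

lemma inv_dilation:
  assumes "0 < a"
  shows "inv (dilation a) f = (\<lambda>t. complex_of_real (sqrt a) * f (a * t))"
proof -
  have *: "dilation a (\<lambda>t. complex_of_real (sqrt a) * f (a * t)) = f" for f
    using assms by (auto simp: dilation_def fun_eq_iff field_simps)
  have "inj (dilation a)"
  proof (rule injI)
    fix f g assume "dilation a f = dilation a g"
    then have "dilation a f (a * t) = dilation a g (a * t)" for t by simp
    then show "f = g" using assms by (auto simp: dilation_def fun_eq_iff)
  qed
  then show ?thesis using * inv_f_eq by metis
qed

lemma hermite_fun_2:
  "hermite_fun 2 t = complex_of_real (2 powr (- 1/4) * (- 1 + 4 * pi * t\<^sup>2) * exp (- pi * t\<^sup>2))"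
proof -
  have 1: "deriv (\<lambda>s. exp (- 2 * pi * s\<^sup>2)) = (\<lambda>s. - 4 * pi * s * exp (- 2 * pi * s\<^sup>2))"
    by (rule ext, rule DERIV_imp_deriv) (auto intro!: derivative_eq_intros)
  have 2: "deriv (\<lambda>s. - 4 * pi * s * exp (- 2 * pi * s\<^sup>2)) t
      = (16 * pi\<^sup>2 * t\<^sup>2 - 4 * pi) * exp (- 2 * pi * t\<^sup>2)"
    by (rule DERIV_imp_deriv)
      (auto intro!: derivative_eq_intros simp: power2_eq_square algebra_simps)
  have d: "(deriv ^^ 2) (\<lambda>s. exp (- 2 * pi * s\<^sup>2)) t
      = (16 * pi\<^sup>2 * t\<^sup>2 - 4 * pi) * exp (- 2 * pi * t\<^sup>2)"
    using 1 2 by (simp add: numeral_2_eq_2)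
  have s: "sqrt (fact 2 * (2 * pi) ^ 2 * 2 ^ 2) = 4 * pi * sqrt 2"
    by (rule real_sqrt_unique) (auto simp: power_mult_distrib)
  have "2 powr (1/4) / sqrt 2 = 2 powr (1/4 - 1/2 :: real)"
    by (simp only: powr_diff powr_half_sqrt[of 2, simplified])
  then have p: "2 powr (1/4) = sqrt 2 * (2 powr (- 1/4) :: real)"
    by (simp add: field_simps)
  have e: "exp (pi * t\<^sup>2) * exp (- 2 * pi * t\<^sup>2) = exp (- pi * t\<^sup>2)"
    by (simp flip: exp_add)
  have c: "2 powr (1/4) / (4 * pi * sqrt 2) = 2 powr (- 1/4) / (4 * pi)"
    by (simp add: p)
  have q: "(16 * pi\<^sup>2 * t\<^sup>2 - 4 * pi) / (4 * pi) = - 1 + 4 * pi * t\<^sup>2"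
    by (simp add: field_simps power2_eq_square)
  have "(- 1) ^ 2 * (2 powr (1/4) / sqrt (fact 2 * (2 * pi) ^ 2 * 2 ^ 2)) * exp (pi * t\<^sup>2)
      * (deriv ^^ 2) (\<lambda>s. exp (- 2 * pi * s\<^sup>2)) t
      = 2 powr (- 1/4) * ((16 * pi\<^sup>2 * t\<^sup>2 - 4 * pi) / (4 * pi))
          * (exp (pi * t\<^sup>2) * exp (- 2 * pi * t\<^sup>2))"
    by (simp only: s d c) simp
  then show ?thesis
    unfolding hermite_fun_def by (simp only: e q)
qed

end

theory Submission
  imports Defs
begin

text \<open>
  The lattice \<open>\<int>\<^sup>2\<close> has critical density, and the Zak transform turns the Gabor coefficients over
  \<open>\<int>\<^sup>2 + z\<close> into multiplication by a translate of the Zak transform of the window. So the union of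
  finitely many translates \<open>\<int>\<^sup>2 + z\<^sub>m\<close> fails to give a frame as soon as all points \<open>(- x\<^sub>m, \<omega>\<^sub>m)\<close> are
  zeros of that transform: indicators of long trains of short intervals \<open>[k, k + \<delta>]\<close>, \<open>k < N\<close>, are
  concentrated there and violate the lower bound. By Bessel's inequality in the modulation variable
  only sums over the translation variable have to be estimated. Evenness gives the dilated second
  Hermite function a zero at \<open>(1/2, 1/2)\<close>, and sign changes on the lines \<open>\<omega> = 0\<close> and \<open>\<omega> = 1/2\<close> give two
  symmetric pairs, hence five zeros modulo \<open>\<int>\<^sup>2\<close>.
\<close>

section \<open>Gabor systems over translates of the integer lattice\<close>

text \<open>The differentiated geometric series with ratio \<open>exp (- 1)\<close>, used on both
  half-lines. The weight \<open>1 + \<bar>j\<bar>\<close> pays for the block positions displaced by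
  a shift by \<open>j\<close>.\<close>

lemma summable_on_int_exp:
  "(\<lambda>j::int. (1 + \<bar>real_of_int j\<bar>) * exp (- \<bar>real_of_int j\<bar>)) summable_on UNIV" (is "?f summable_on _")
proof -
  have "(\<lambda>n. real (Suc n) * exp (- 1) ^ n) sums (1 / (1 - exp (- 1))\<^sup>2)"
    by (rule geometric_deriv_sums) simp
  then have "summable (\<lambda>n. norm ((1 + real n) * exp (- real n)))"
    by (simp add: sums_iff exp_of_nat_mult[symmetric] add_ac)
  then have nat: "(\<lambda>n. (1 + real n) * exp (- real n)) summable_on UNIV"
    by (rule norm_summable_imp_summable_on)
  have "?f summable_on range int"
    using nat by (subst summable_on_reindex) (auto simp: o_def)
  moreover have "?f summable_on range (\<lambda>n. - int n)"
    using nat by (subst summable_on_reindex) (auto simp: o_def inj_def)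
  ultimately have "?f summable_on (range int \<union> range (\<lambda>n. - int n))"
    by (rule summable_on_union)
  moreover have "range int \<union> range (\<lambda>n. - int n) = UNIV"
    by (auto simp: image_iff) (metis int_cases2)
  ultimately show ?thesis by simp
qed

lemma has_sum_finite_sum:
  fixes f :: "'i \<Rightarrow> 'a \<Rightarrow> 'b::topological_comm_monoid_add"
  assumes "\<And>i. i \<in> F \<Longrightarrow> (f i has_sum s i) A"
  shows "((\<lambda>x. \<Sum>i\<in>F. f i x) has_sum (\<Sum>i\<in>F. s i)) A"
  using assms by (induction F rule: infinite_finite_induct) (auto intro: has_sum_add)

text \<open>
  Away from the ends of the block the inner sum is nearly the full sum over \<open>\<int>\<close>; shifting a block by \<open>j\<close>
  changes it in at most \<open>2\<bar>j\<bar>\<close> places, so the error does not grow with \<open>N\<close>.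
\<close>
lemma block_sum_l2_bound:
  fixes b :: "int \<Rightarrow> complex"
  assumes sm: "(\<lambda>j. (1 + \<bar>real_of_int j\<bar>) * cmod (b j)) summable_on UNIV" and F: "finite F"
  defines "B \<equiv> \<Sum>\<^sub>\<infinity>j. (1 + \<bar>real_of_int j\<bar>) * cmod (b j)"
  shows "(\<Sum>n\<in>F. (cmod (\<Sum>k<N. b (int k - n)))\<^sup>2) \<le> 2 * real N * (cmod (\<Sum>\<^sub>\<infinity>j. b j))\<^sup>2 + 4 * B\<^sup>2"
proof -
  \<comment> \<open>As a weight on \<int>, the block indicator turns \<open>a n\<close> into a sum
    over all \<open>j\<close> with coefficients \<open>\<iota> (n + j)\<close>, to be compared with
    \<open>\<iota> n\<close> times the full sum \<open>Z\<close>.\<close>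
  define \<iota> :: "int \<Rightarrow> real" where "\<iota> = indicator {0..<int N}"
  define a where "a n = (\<Sum>k<N. b (int k - n))" for n
  define Z where "Z = (\<Sum>\<^sub>\<infinity>j. b j)"
  define d where "d n j = \<bar>\<iota> (n + j) - \<iota> n\<bar>" for n j
  define e where "e n = a n - \<iota> n * Z" for n
  have d_bounds: "0 \<le> d n j" "d n j \<le> 1" for n j
    by (simp_all add: d_def \<iota>_def indicator_def)
  have nb: "(\<lambda>j. cmod (b j)) summable_on UNIV"
    by (rule summable_on_comparison_test[OF sm]) (auto simp: algebra_simps)
  have sd: "(\<lambda>j. d n j * cmod (b j)) summable_on UNIV" for n
    by (rule summable_on_comparison_test[OF nb]) (use d_bounds mult_right_mono[OF d_bounds(2) norm_ge_zero] in simp_all)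
  have bs: "(b has_sum Z) UNIV"
    using nb abs_summable_summable unfolding Z_def by (intro has_sum_infsum) blast
  have hs: "((\<lambda>j. of_real (\<iota> (n + j) - \<iota> n) * b j) has_sum e n) UNIV" for n
  proof -
    have "((\<lambda>j. of_real (\<iota> (n + j)) * b j) has_sum a n) UNIV"
    proof (rule has_sum_finite_neutralI[where B="(\<lambda>k. int k - n) ` {..<N}"])
      show "a n = (\<Sum>j\<in>(\<lambda>k. int k - n) ` {..<N}. of_real (\<iota> (n + j)) * b j)"
        by (subst sum.reindex) (auto simp: a_def inj_on_def \<iota>_def)
      fix j assume "j \<in> UNIV - (\<lambda>k. int k - n) ` {..<N}"
      then have "n + j \<notin> {0..<int N}"
        using image_eqI[of j "\<lambda>k. int k - n" "nat (n + j)" "{..<N}"] by fastforce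
      then show "of_real (\<iota> (n + j)) * b j = 0" by (simp add: \<iota>_def)
    qed auto
    from has_sum_add[OF this has_sum_cmult_right[OF bs, of "- of_real (\<iota> n)"]]
    show ?thesis by (simp add: e_def algebra_simps)
  qed
  have e_le: "cmod (e n) \<le> (\<Sum>\<^sub>\<infinity>j. d n j * cmod (b j))" for n
    by (rule norm_infsum_le[OF hs has_sum_infsum[OF sd]])
       (simp add: norm_mult d_def del: of_real_diff)
  have e_le_B: "cmod (e n) \<le> B" for n
  proof -
    have "(\<Sum>\<^sub>\<infinity>j. d n j * cmod (b j)) \<le> B"
      unfolding B_def
    proof (rule infsum_mono[OF sd sm])
      fix j show "d n j * cmod (b j) \<le> (1 + \<bar>real_of_int j\<bar>) * cmod (b j)"
        using d_bounds[of n j] by (intro mult_right_mono) simp_all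
    qed
    with e_le[of n] show ?thesis by simp
  qed
  have card_ind: "(\<Sum>n\<in>F. indicator D n :: real) = real (card (F \<inter> D))" for D
    using F by (simp add: indicator_def)
  have d_count: "(\<Sum>n\<in>F. d n j) \<le> 2 * \<bar>real_of_int j\<bar>" for j
  proof -
    \<comment> \<open>Membership of \<open>n + j\<close> and of \<open>n\<close> in the block can
      differ only for \<open>n\<close> between \<open>0\<close> and \<open>- j\<close> or between
      \<open>N\<close> and \<open>N - j\<close>; each window holds \<open>\<bar>j\<bar>\<close>
      integers.\<close>
    let ?D = "{min 0 (- j)..<max 0 (- j)} \<union> {min (int N) (int N - j)..<max (int N) (int N - j)}"
    have "(\<Sum>n\<in>F. d n j) \<le> (\<Sum>n\<in>F. indicator ?D n)"
    proof (rule sum_mono)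
      fix n
      show "d n j \<le> indicator ?D n"
      proof (cases "n \<in> ?D")
        case False
        then have "n + j \<in> {0..<int N} \<longleftrightarrow> n \<in> {0..<int N}"
          unfolding Un_iff atLeastLessThan_iff by linarith
        then have "\<iota> (n + j) = \<iota> n" by (simp only: \<iota>_def indicator_def)
        then show ?thesis by (simp add: d_def)
      qed (simp add: d_bounds)
    qed
    also have "\<dots> = real (card (F \<inter> ?D))"
      by (rule card_ind)
    also have "card (F \<inter> ?D) \<le> card ?D"
      by (intro card_mono) auto
    also have "card ?D \<le> card {min 0 (- j)..<max 0 (- j)} + card {min (int N) (int N - j)..<max (int N) (int N - j)}"
      by (rule card_Un_le)
    also have "\<dots> = 2 * nat \<bar>j\<bar>" by (auto simp: min_def max_def)
    finally show ?thesis by simp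
  qed
  \<comment> \<open>Summing over \<open>n\<close> first leaves at most
    \<open>2 * \<bar>j\<bar>\<close> in front of \<open>cmod (b j)\<close>, which the weight in
    \<open>B\<close> absorbs.\<close>
  have "(\<Sum>n\<in>F. cmod (e n)) \<le> (\<Sum>n\<in>F. \<Sum>\<^sub>\<infinity>j. d n j * cmod (b j))"
    by (intro sum_mono e_le)
  also have "\<dots> = (\<Sum>\<^sub>\<infinity>j. \<Sum>n\<in>F. d n j * cmod (b j))"
    by (intro infsumI[symmetric] has_sum_finite_sum has_sum_infsum sd)
  also have "\<dots> \<le> (\<Sum>\<^sub>\<infinity>j. 2 * ((1 + \<bar>real_of_int j\<bar>) * cmod (b j)))"
  proof (rule infsum_mono)
    fix j show "(\<Sum>n\<in>F. d n j * cmod (b j)) \<le> 2 * ((1 + \<bar>real_of_int j\<bar>) * cmod (b j))"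
    proof -
      have "(\<Sum>n\<in>F. d n j * cmod (b j)) = (\<Sum>n\<in>F. d n j) * cmod (b j)"
        by (rule sum_distrib_right[symmetric])
      also have "\<dots> \<le> (2 * \<bar>real_of_int j\<bar>) * cmod (b j)"
        by (intro mult_right_mono d_count) simp
      also have "\<dots> \<le> (2 * (1 + \<bar>real_of_int j\<bar>)) * cmod (b j)"
        by (intro mult_right_mono) simp_all
      finally show ?thesis by (simp only: mult.assoc)
    qed
  qed (rule has_sum_imp_summable[OF has_sum_finite_sum[OF has_sum_infsum[OF sd]]],
      rule summable_on_cmult_right[OF sm])
  also have "\<dots> = 2 * B"
    unfolding B_def by (rule infsum_cmult_right')
  finally have sum_e: "(\<Sum>n\<in>F. cmod (e n)) \<le> 2 * B" .
  have B0: "0 \<le> B" unfolding B_def by (intro infsum_nonneg) auto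
  \<comment> \<open>The uniform bound \<open>B\<close> on the single errors upgrades the bound on
    their sum to one on the sum of squares, independent of \<open>N\<close> and
    \<open>F\<close>.\<close>
  have sum_e2: "(\<Sum>n\<in>F. (cmod (e n))\<^sup>2) \<le> 2 * B\<^sup>2"
  proof -
    have "(\<Sum>n\<in>F. (cmod (e n))\<^sup>2) \<le> (\<Sum>n\<in>F. B * cmod (e n))"
      by (intro sum_mono) (auto simp: power2_eq_square intro!: mult_right_mono e_le_B)
    also have "\<dots> \<le> B * (2 * B)"
      unfolding sum_distrib_left[symmetric] by (intro mult_left_mono sum_e B0)
    finally show ?thesis by (simp add: power2_eq_square)
  qed
  have sum_chi: "(\<Sum>n\<in>F. \<iota> n) \<le> real N"
  proof -
    have "(\<Sum>n\<in>F. \<iota> n) = real (card (F \<inter> {0..<int N}))"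
      by (simp add: \<iota>_def card_ind)
    also have "card (F \<inter> {0..<int N}) \<le> card {0..<int N}"
      by (intro card_mono) auto
    finally show ?thesis by simp
  qed
  have "(\<Sum>n\<in>F. (cmod (a n))\<^sup>2) \<le> (\<Sum>n\<in>F. 2 * (cmod (e n))\<^sup>2 + 2 * \<iota> n * (cmod Z)\<^sup>2)"
  proof (rule sum_mono)
    fix n
    have "cmod (a n) \<le> cmod (e n) + \<iota> n * cmod Z"
      using norm_triangle_ineq[of "e n" "\<iota> n * Z"] by (simp add: e_def norm_mult \<iota>_def)
    then have "(cmod (a n))\<^sup>2 \<le> (cmod (e n) + \<iota> n * cmod Z)\<^sup>2"
      by (rule power_mono) simp
    also have "\<dots> \<le> 2 * (cmod (e n))\<^sup>2 + 2 * (\<iota> n * cmod Z)\<^sup>2"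
      using zero_le_power2[of "cmod (e n) - \<iota> n * cmod Z"] by (simp add: power2_eq_square algebra_simps)
    also have "(\<iota> n * cmod Z)\<^sup>2 = \<iota> n * (cmod Z)\<^sup>2"
      by (simp add: \<iota>_def indicator_def)
    finally show "(cmod (a n))\<^sup>2 \<le> 2 * (cmod (e n))\<^sup>2 + 2 * \<iota> n * (cmod Z)\<^sup>2" by simp
  qed
  also have "\<dots> = 2 * (\<Sum>n\<in>F. (cmod (e n))\<^sup>2) + 2 * (\<Sum>n\<in>F. \<iota> n) * (cmod Z)\<^sup>2"
    by (simp add: sum.distrib sum_distrib_left sum_distrib_right)
  also have "\<dots> \<le> 2 * (2 * B\<^sup>2) + 2 * real N * (cmod Z)\<^sup>2"
    using sum_e2 sum_chi by (intro add_mono mult_left_mono mult_right_mono) auto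
  finally show ?thesis by (simp add: a_def Z_def)
qed

section \<open>Orthonormal characters and Bessel's inequality\<close>

lemma integral_cis_int:
  "integral {0..1} (\<lambda>t. cis (2 * pi * of_int l * t)) = of_bool (l = 0)"
proof (cases "l = 0")
  case False
  let ?c = "2 * pi * real_of_int l"
  have "((\<lambda>t. cis (?c * t)) has_integral cis (?c * 1) / (\<i> * ?c) - cis (?c * 0) / (\<i> * ?c)) {0..1}"
  proof (rule fundamental_theorem_of_calculus)
    fix t :: real
    show "((\<lambda>t. cis (?c * t) / (\<i> * ?c)) has_vector_derivative cis (?c * t)) (at t within {0..1})"
      unfolding cis_conv_exp using False
      by (auto intro!: derivative_eq_intros has_vector_derivative_real_field simp: field_simps)
  qed simp
  moreover have "cis (?c * 1) = 1"
    using cis_multiple_2pi[of "of_int l"] by simp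
  ultimately show ?thesis using False by (simp add: integral_unique)
qed simp

text \<open>The trigonometric polynomial \<open>P\<close> built from the coefficients
  \<open>c l\<close> of \<phi> pairs with \<phi> to \<open>S\<close>, the sum of their squared
  moduli, and by orthonormality \<open>S\<close> is also its squared norm on the unit
  interval.\<close>

lemma bessel_cis:
  fixes \<phi> :: "real \<Rightarrow> complex"
  assumes \<phi>: "continuous_on {0..\<delta>} \<phi>" and \<delta>: "\<delta> \<le> 1" and L: "finite L"
  shows "(\<Sum>l\<in>L. (cmod (integral {0..\<delta>} (\<lambda>t. cis (- (2 * pi * of_int l * t)) * \<phi> t)))\<^sup>2)
    \<le> integral {0..\<delta>} (\<lambda>t. (cmod (\<phi> t))\<^sup>2)"
proof -
  define e where "e l t = cis (2 * pi * of_int l * t)" for l :: int and t :: real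
  define c where "c l = integral {0..\<delta>} (\<lambda>t. cnj (e l t) * \<phi> t)" for l
  define P where "P t = (\<Sum>l\<in>L. c l * e l t)" for t
  define S where "S = (\<Sum>l\<in>L. (cmod (c l))\<^sup>2)"
  have ce [continuous_intros]: "continuous_on A (e l)" for A l
    unfolding e_def by (intro continuous_intros)
  have cP [continuous_intros]: "continuous_on A P" for A
    unfolding P_def by (intro continuous_intros)
  have "complex_of_real ((cmod (P t))\<^sup>2) = (\<Sum>l\<in>L. \<Sum>m\<in>L. c l * cnj (c m) * e (l - m) t)" for t
    unfolding complex_norm_square P_def cnj_sum sum_product
    by (intro sum.cong refl) (simp add: e_def cis_cnj cis_mult algebra_simps)
  then have "integral {0..1} (\<lambda>t. complex_of_real ((cmod (P t))\<^sup>2))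
      = (\<Sum>l\<in>L. \<Sum>m\<in>L. c l * cnj (c m) * of_bool (l - m = 0))"
    by (simp add: integral_sum integrable_sum L integrable_continuous_interval continuous_intros
        integral_mult_right integral_cis_int[folded e_def] del: of_real_power)
  also have "\<dots> = complex_of_real S"
    unfolding S_def of_real_sum complex_norm_square
    by (intro sum.cong refl) (simp add: L of_bool_def if_distrib[of "\<lambda>x. _ * x"] cong: if_cong)
  finally have PP: "integral {0..1} (\<lambda>t. (cmod (P t))\<^sup>2) = S"
    using integral_linear[OF integrable_continuous_interval bounded_linear_of_real[where 'a=complex],
        of 0 1 "\<lambda>t. (cmod (P t))\<^sup>2"]
    by (simp add: o_def continuous_intros del: of_real_power)
  have "integral {0..\<delta>} (\<lambda>t. cnj (P t) * \<phi> t)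
      = integral {0..\<delta>} (\<lambda>t. \<Sum>l\<in>L. cnj (c l) * (cnj (e l t) * \<phi> t))"
    by (simp add: P_def sum_distrib_right mult.assoc)
  also have "\<dots> = (\<Sum>l\<in>L. cnj (c l) * c l)"
    unfolding c_def
    by (subst integral_sum[OF L])
       (auto simp: integral_mult_right intro!: integrable_continuous_interval continuous_intros \<phi>)
  also have "\<dots> = complex_of_real S"
    by (simp add: S_def complex_norm_square mult.commute del: of_real_power)
  finally have "S = cmod (integral {0..\<delta>} (\<lambda>t. cnj (P t) * \<phi> t))"
    by (simp only: norm_of_real) (simp add: S_def sum_nonneg)
  \<comment> \<open>The pointwise inequality between arithmetic and geometric mean stands in for
    Cauchy-Schwarz; the resulting \<open>S / 2\<close> is absorbed on the left at the end.\<close>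
  also have "\<dots> \<le> integral {0..\<delta>} (\<lambda>t. ((cmod (\<phi> t))\<^sup>2 + (cmod (P t))\<^sup>2) / 2)"
  proof (rule integral_norm_bound_integral)
    fix t show "cmod (cnj (P t) * \<phi> t) \<le> ((cmod (\<phi> t))\<^sup>2 + (cmod (P t))\<^sup>2) / 2"
      using zero_le_power2[of "cmod (\<phi> t) - cmod (P t)"]
      by (simp add: norm_mult power2_eq_square algebra_simps)
  qed (auto intro!: integrable_continuous_interval continuous_intros \<phi>)
  also have "\<dots> = (integral {0..\<delta>} (\<lambda>t. (cmod (\<phi> t))\<^sup>2) + integral {0..\<delta>} (\<lambda>t. (cmod (P t))\<^sup>2)) / 2"
    by (subst integral_divide, subst Henstock_Kurzweil_Integration.integral_add)
       (auto intro!: integrable_continuous_interval continuous_intros \<phi>)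
  \<comment> \<open>Enlarging the interval to a full period, possible as
    \<open>\<delta> \<le> 1\<close>, bounds the mass of \<open>P\<close> by
    \<open>S\<close>.\<close>
  also have "integral {0..\<delta>} (\<lambda>t. (cmod (P t))\<^sup>2) \<le> integral {0..1} (\<lambda>t. (cmod (P t))\<^sup>2)"
    using \<delta> by (intro integral_subset_le) (auto intro!: integrable_continuous_interval continuous_intros)
  finally have "S \<le> integral {0..\<delta>} (\<lambda>t. (cmod (\<phi> t))\<^sup>2)"
    by (simp add: PP)
  then show ?thesis by (simp add: S_def c_def e_def cis_cnj)
qed

section \<open>Gabor coefficients of a train of intervals\<close>

text \<open>Each interval is moved back to \<open>{0..\<delta>}\<close>. A move by the integer
  \<open>k\<close> does not affect the modulation by \<open>l\<close>, so only the phase from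
  \<open>w\<close> remains, and the coefficient is the \<open>l\<close>-th Fourier coefficient of a
  function that does not depend on \<open>l\<close>.\<close>

lemma L2_inner_indicator_tf_shift:
  assumes g: "continuous_on UNIV g" and \<delta>: "0 < \<delta>" "\<delta> < 1"
  shows "L2_inner (indicator (\<Union>k<N. {real k..real k + \<delta>})) (tf_shift (of_int n + x, of_int l + w) g)
    = integral {0..\<delta>} (\<lambda>t. cis (- (2 * pi * of_int l * t)) *
        (cis (- (2 * pi * w * t)) * cnj (\<Sum>k<N. cis (2 * pi * w * k) * g (t - x + of_int (int k - n)))))"
proof -
  define h where "h t = cnj (tf_shift (of_int n + x, of_int l + w) g t)" for t
  have h: "continuous_on A h" for A
    unfolding h_def tf_shift_def
    by (intro continuous_intros continuous_on_compose2[OF g]) auto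
  have si: "set_integrable lborel {a..b} h" for a b
    by (intro borel_integrable_atLeastAtMost' h)
  have disj: "disjoint_family_on (\<lambda>k. {real k..real k + \<delta>}) {..<N}"
    using \<delta> by (auto simp: disjoint_family_on_def)
  have "L2_inner (indicator (\<Union>k<N. {real k..real k + \<delta>})) (tf_shift (of_int n + x, of_int l + w) g)
      = (\<integral>t. (\<Sum>k<N. indicator {real k..real k + \<delta>} t *\<^sub>R h t) \<partial>lborel)"
    unfolding L2_inner_def h_def[symmetric] indicator_UN_disjoint[OF finite_lessThan disj]
      sum_distrib_right
    by (intro Bochner_Integration.integral_cong sum.cong refl) (simp add: indicator_def)
  also have "\<dots> = (\<Sum>k<N. \<integral>t. indicator {real k..real k + \<delta>} t *\<^sub>R h t \<partial>lborel)"
    using si by (intro Bochner_Integration.integral_sum) (simp add: set_integrable_def)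
  also have "\<dots> = (\<Sum>k<N. integral {0..\<delta>} (\<lambda>t. h (t + k)))"
  proof (rule sum.cong[OF refl])
    fix k
    have "(\<integral>t. indicator {real k..real k + \<delta>} t *\<^sub>R h t \<partial>lborel)
        = (\<integral>t. indicator {0..\<delta>} t *\<^sub>R h (t + k) \<partial>lborel)"
      by (subst lborel_integral_real_affine[where c=1 and t="real k"])
         (auto intro!: Bochner_Integration.integral_cong simp: indicator_def add.commute)
    also have "\<dots> = integral {0..\<delta>} (\<lambda>t. h (t + k))"
      by (subst set_borel_integral_eq_integral(2)[symmetric, unfolded set_lebesgue_integral_def])
         (auto intro!: borel_integrable_atLeastAtMost' continuous_on_compose2[OF h[of UNIV]] continuous_intros)
    finally show "(\<integral>t. indicator {real k..real k + \<delta>} t *\<^sub>R h t \<partial>lborel) = integral {0..\<delta>} (\<lambda>t. h (t + k))" .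
  qed
  also have "\<dots> = integral {0..\<delta>} (\<lambda>t. \<Sum>k<N. h (t + k))"
    by (rule integral_sum[symmetric])
       (auto intro!: integrable_continuous_interval continuous_on_compose2[OF h[of UNIV]] continuous_intros)
  also have "\<dots> = integral {0..\<delta>} (\<lambda>t. cis (- (2 * pi * of_int l * t)) *
        (cis (- (2 * pi * w * t)) * cnj (\<Sum>k<N. cis (2 * pi * w * k) * g (t - x + of_int (int k - n)))))"
  proof (rule Henstock_Kurzweil_Integration.integral_cong)
    fix t :: real
    have "h (t + k) = cis (- (2 * pi * of_int l * t)) * (cis (- (2 * pi * w * t)) *
        cnj (cis (2 * pi * w * k) * g (t - x + of_int (int k - n))))" for k :: nat
    proof -
      have "exp (2 * complex_of_real pi * \<i> * complex_of_real ((of_int l + w) * (t + k)))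
          = cis (2 * pi * of_int (l * int k)) * (cis (2 * pi * of_int l * t) * (cis (2 * pi * w * t) * cis (2 * pi * w * k)))"
        unfolding cis_conv_exp exp_add[symmetric] by (simp add: algebra_simps)
      also have "cis (2 * pi * of_int (l * int k)) = 1"
        by (rule cis_multiple_2pi) simp
      finally show ?thesis
        by (simp add: h_def tf_shift_def cis_cnj algebra_simps)
    qed
    then show "(\<Sum>k<N. h (t + k)) = cis (- (2 * pi * of_int l * t)) *
        (cis (- (2 * pi * w * t)) * cnj (\<Sum>k<N. cis (2 * pi * w * k) * g (t - x + of_int (int k - n))))"
      by (simp add: sum_distrib_left)
  qed
  finally show ?thesis .
qed

section \<open>The Zak transform: convergence and continuity\<close>

text \<open>With this sign in the exponent, the block sums in
  \<open>L2_inner_indicator_tf_shift\<close> are, up to a unimodular factor, truncations of the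
  series at \<open>u = t - x\<close>. A series that is not summable would get the default value 0;
  \<open>has_sum_zak\<close> excludes this under exponential decay.\<close>

definition zak :: "(real \<Rightarrow> complex) \<Rightarrow> real \<Rightarrow> real \<Rightarrow> complex" where
  "zak g u w = (\<Sum>\<^sub>\<infinity>j::int. g (u + of_int j) * cis (2 * pi * w * of_int j))"

lemma decay_shift:
  assumes decay: "\<And>t. cmod (g t) \<le> C * exp (- \<bar>t\<bar>)" and u: "\<bar>u\<bar> \<le> R"
  shows "cmod (g (u + of_int j)) \<le> C * exp R * exp (- \<bar>real_of_int j\<bar>)"
proof -
  have "0 \<le> C" using order_trans[OF norm_ge_zero decay[of 0]] by simp
  have "exp (- \<bar>u + of_int j\<bar>) \<le> exp (R + - \<bar>real_of_int j\<bar>)"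
    using u by simp
  then have "C * exp (- \<bar>u + of_int j\<bar>) \<le> C * exp R * exp (- \<bar>real_of_int j\<bar>)"
    using \<open>0 \<le> C\<close> unfolding exp_add mult.assoc by (rule mult_left_mono)
  with decay[of "u + of_int j"] show ?thesis by simp
qed

text \<open>Both conclusions come from one majorant that depends on \<open>u\<close> only through
  \<open>R\<close>, so the error constant of the block estimate is uniform for bounded
  \<open>u\<close>.\<close>

lemma summable_on_decay_weighted:
  assumes decay: "\<And>t. cmod (g t) \<le> C * exp (- \<bar>t\<bar>)" and u: "\<bar>u\<bar> \<le> R"
  shows "(\<lambda>j::int. (1 + \<bar>real_of_int j\<bar>) * cmod (g (u + of_int j))) summable_on UNIV"
    and "(\<Sum>\<^sub>\<infinity>j::int. (1 + \<bar>real_of_int j\<bar>) * cmod (g (u + of_int j)))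
      \<le> C * exp R * (\<Sum>\<^sub>\<infinity>j::int. (1 + \<bar>real_of_int j\<bar>) * exp (- \<bar>real_of_int j\<bar>))"
proof -
  let ?M = "\<lambda>j::int. C * exp R * ((1 + \<bar>real_of_int j\<bar>) * exp (- \<bar>real_of_int j\<bar>))"
  have M: "?M summable_on UNIV"
    by (intro summable_on_cmult_right summable_on_int_exp)
  have le: "(1 + \<bar>real_of_int j\<bar>) * cmod (g (u + of_int j)) \<le> ?M j" for j
    using mult_left_mono[OF decay_shift[where g=g, OF decay u, of j], of "1 + \<bar>real_of_int j\<bar>"]
    by (simp add: mult_ac)
  show sm: "(\<lambda>j::int. (1 + \<bar>real_of_int j\<bar>) * cmod (g (u + of_int j))) summable_on UNIV"
    by (rule summable_on_comparison_test[OF M le]) simp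
  have "(\<Sum>\<^sub>\<infinity>j::int. (1 + \<bar>real_of_int j\<bar>) * cmod (g (u + of_int j))) \<le> infsum ?M UNIV"
    by (rule infsum_mono[OF sm M le])
  then show "(\<Sum>\<^sub>\<infinity>j::int. (1 + \<bar>real_of_int j\<bar>) * cmod (g (u + of_int j)))
      \<le> C * exp R * (\<Sum>\<^sub>\<infinity>j::int. (1 + \<bar>real_of_int j\<bar>) * exp (- \<bar>real_of_int j\<bar>))"
    by (simp only: infsum_cmult_right')
qed

lemma summable_on_int_exp': "(\<lambda>j::int. exp (- \<bar>real_of_int j\<bar>)) summable_on UNIV"
  by (rule summable_on_comparison_test[OF summable_on_int_exp]) (simp_all add: distrib_right)

lemma has_sum_zak:
  assumes decay: "\<And>t. cmod (g t) \<le> C * exp (- \<bar>t\<bar>)"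
  shows "((\<lambda>j::int. g (u + of_int j) * cis (2 * pi * w * of_int j)) has_sum zak g u w) UNIV"
proof -
  have "(\<lambda>j::int. cmod (g (u + of_int j) * cis (2 * pi * w * of_int j))) summable_on UNIV"
    by (rule summable_on_comparison_test[OF summable_on_decay_weighted(1)[where g=g, OF decay order_refl[of "\<bar>u\<bar>"]]])
       (simp_all add: norm_mult distrib_right)
  then show ?thesis
    unfolding zak_def by (rule has_sum_infsum[OF abs_summable_summable])
qed

text \<open>The Weierstrass test on a compact neighbourhood of each point, where the decay gives a
  summable majorant.\<close>

lemma continuous_on_zak:
  assumes cont: "continuous_on UNIV g" and decay: "\<And>t. cmod (g t) \<le> C * exp (- \<bar>t\<bar>)"
  shows "continuous_on A (\<lambda>u. zak g u w)"
proof (intro continuous_at_imp_continuous_on ballI)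
  fix u :: real
  define R where "R = \<bar>u\<bar> + 1"
  have "uniform_limit {-R..R} (\<lambda>X u. \<Sum>j\<in>X. g (u + of_int j) * cis (2 * pi * w * of_int j))
      (\<lambda>u. zak g u w) (finite_subsets_at_top UNIV)"
    unfolding zak_def
  proof (rule Weierstrass_m_test_general)
    fix j :: int and u assume "u \<in> {-R..R}"
    then have "\<bar>u\<bar> \<le> R" by auto
    from decay_shift[where g=g, OF decay this]
    show "cmod (g (u + of_int j) * cis (2 * pi * w * of_int j)) \<le> C * exp R * exp (- \<bar>real_of_int j\<bar>)"
      by (simp add: norm_mult)
  qed (intro summable_on_cmult_right summable_on_int_exp')
  moreover have "continuous_on {-R..R} (\<lambda>u. \<Sum>j\<in>X. g (u + of_int j) * cis (2 * pi * w * of_int j))"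
    for X :: "int set"
    by (intro continuous_intros continuous_on_compose2[OF cont]) auto
  ultimately have "continuous_on {-R..R} (\<lambda>u. zak g u w)"
    by (intro uniform_limit_theorem[where F="finite_subsets_at_top UNIV"] always_eventually) auto
  moreover have "u \<in> interior {-R..R}" by (auto simp: R_def)
  ultimately show "isCont (\<lambda>u. zak g u w) u"
    by (rule continuous_on_interior)
qed

section \<open>Failure of the lower frame bound\<close>

text \<open>The order of quantifiers is the point: \<open>B\<close> comes from the ends of the train
  and precedes \<epsilon>, the admissible width comes from continuity of the Zak transform at its
  zero, and \<open>N\<close> stays free. A large \<open>N\<close> chosen afterwards makes
  \<open>B\<close> negligible.\<close>

lemma gabor_block_bound:
  assumes cont: "continuous_on UNIV g" and decay: "\<And>t. cmod (g t) \<le> C * exp (- \<bar>t\<bar>)"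
    and zero: "zak g (- x) w = 0"
  shows "\<exists>B. \<forall>\<epsilon>>0. \<exists>\<delta>\<^sub>0>0. \<forall>\<delta> N F L. 0 < \<delta> \<longrightarrow> \<delta> \<le> \<delta>\<^sub>0 \<longrightarrow> \<delta> < 1 \<longrightarrow> finite F \<longrightarrow> finite L \<longrightarrow>
    (\<Sum>n\<in>F. \<Sum>l\<in>L. (cmod (L2_inner (indicator (\<Union>k<N. {real k..real k + \<delta>}))
        (tf_shift (of_int n + x, of_int l + w) g)))\<^sup>2) \<le> \<delta> * (2 * real N * \<epsilon> + B)"
proof -
  define S where "S = (\<Sum>\<^sub>\<infinity>j::int. (1 + \<bar>real_of_int j\<bar>) * exp (- \<bar>real_of_int j\<bar>))"
  define B where "B = 4 * (C * exp (1 + \<bar>x\<bar>) * S)\<^sup>2"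
  have "\<exists>\<delta>\<^sub>0>0. \<forall>\<delta> N F L. 0 < \<delta> \<longrightarrow> \<delta> \<le> \<delta>\<^sub>0 \<longrightarrow> \<delta> < 1 \<longrightarrow> finite F \<longrightarrow> finite L \<longrightarrow>
    (\<Sum>n\<in>F. \<Sum>l\<in>L. (cmod (L2_inner (indicator (\<Union>k<N. {real k..real k + \<delta>}))
        (tf_shift (of_int n + x, of_int l + w) g)))\<^sup>2) \<le> \<delta> * (2 * real N * \<epsilon> + B)"
    if \<epsilon>: "\<epsilon> > 0" for \<epsilon>
  proof -
    have "isCont (\<lambda>t. zak g (t - x) w) 0"
      using continuous_on_compose2[OF continuous_on_zak[where g=g and A=UNIV, OF cont decay], of UNIV "\<lambda>t. t - x" w]
      by (simp add: continuous_on_eq_continuous_at continuous_intros)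
    then have "((\<lambda>t. (cmod (zak g (t - x) w))\<^sup>2) \<longlongrightarrow> (cmod (zak g (0 - x) w))\<^sup>2) (at 0)"
      unfolding isCont_def by (intro tendsto_intros)
    then have "\<forall>\<^sub>F t in at 0. (cmod (zak g (t - x) w))\<^sup>2 < \<epsilon>"
      using \<epsilon> zero by (intro order_tendstoD) auto
    then obtain r where r: "r > 0" "\<And>t. t \<noteq> 0 \<Longrightarrow> dist t 0 < r \<Longrightarrow> (cmod (zak g (t - x) w))\<^sup>2 < \<epsilon>"
      by (auto simp: eventually_at)
    have small: "(cmod (zak g (t - x) w))\<^sup>2 \<le> \<epsilon>" if "0 \<le> t" "t < r" for t
      using r(2)[of t] that \<epsilon> zero by (cases "t = 0") auto
    show ?thesis
    \<comment> \<open>Halving makes every \<open>t\<close> in \<open>{0..\<delta>}\<close> strictly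
      smaller than \<open>r\<close>, as \<open>small\<close> requires.\<close>
    proof (intro exI[of _ "r/2"] conjI allI impI)
      fix \<delta> :: real and N :: nat and F L :: "int set"
      assume \<delta>: "0 < \<delta>" "\<delta> \<le> r/2" "\<delta> < 1" and F: "finite F" and L: "finite L"
      define b where "b t j = g (t - x + of_int j) * cis (2 * pi * w * of_int j)" for t and j :: int
      define \<phi> where "\<phi> n t = cis (- (2 * pi * w * t)) *
        cnj (\<Sum>k<N. cis (2 * pi * w * k) * g (t - x + of_int (int k - n)))" for n t
      have c\<phi>: "continuous_on A (\<phi> n)" for n A
        unfolding \<phi>_def by (intro continuous_intros continuous_on_compose2[OF cont]) auto
      \<comment> \<open>Writing \<open>k\<close> as \<open>n + (k - n)\<close> in the phase splits
        off a unimodular factor that depends on \<open>n\<close> alone; a block sum of Zak series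
        terms is left.\<close>
      have norm_\<phi>: "cmod (\<phi> n t) = cmod (\<Sum>k<N. b t (int k - n))" for n t
      proof -
        have "(\<Sum>k<N. cis (2 * pi * w * k) * g (t - x + of_int (int k - n)))
            = cis (2 * pi * w * of_int n) * (\<Sum>k<N. b t (int k - n))"
          unfolding sum_distrib_left b_def
          by (intro sum.cong refl) (simp add: cis_mult algebra_simps)
        then show ?thesis by (simp add: \<phi>_def norm_mult del: cnj_sum)
      qed
      have bound: "(\<Sum>n\<in>F. (cmod (\<phi> n t))\<^sup>2) \<le> 2 * real N * \<epsilon> + B" if t: "t \<in> {0..\<delta>}" for t
      proof -
        have tx: "\<bar>t - x\<bar> \<le> 1 + \<bar>x\<bar>" using t \<delta> by auto
        note sw = summable_on_decay_weighted[where g=g, OF decay tx]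
        have nb: "cmod (b t j) = cmod (g (t - x + of_int j))" for j
          by (simp add: b_def norm_mult)
        have "(\<Sum>n\<in>F. (cmod (\<phi> n t))\<^sup>2) \<le> 2 * real N * (cmod (\<Sum>\<^sub>\<infinity>j. b t j))\<^sup>2
            + 4 * (\<Sum>\<^sub>\<infinity>j. (1 + \<bar>real_of_int j\<bar>) * cmod (b t j))\<^sup>2"
          unfolding norm_\<phi> by (rule block_sum_l2_bound) (use sw(1) F in \<open>simp_all add: nb\<close>)
        also have "(\<Sum>\<^sub>\<infinity>j. b t j) = zak g (t - x) w"
          by (simp add: zak_def b_def)
        also have "2 * real N * (cmod (zak g (t - x) w))\<^sup>2 \<le> 2 * real N * \<epsilon>"
          using t \<delta> by (intro mult_left_mono small) auto
        also have "4 * (\<Sum>\<^sub>\<infinity>j. (1 + \<bar>real_of_int j\<bar>) * cmod (b t j))\<^sup>2 \<le> B"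
          unfolding B_def nb using sw(2)
          by (intro mult_left_mono power_mono infsum_nonneg) (auto simp: S_def)
        finally show ?thesis by simp
      qed
      \<comment> \<open>Bessel's inequality disposes of \<open>l\<close> for each fixed
        \<open>n\<close>; the sum over \<open>n\<close> then moves under the integral, where
        \<open>bound\<close> holds pointwise.\<close>
      have "(\<Sum>n\<in>F. \<Sum>l\<in>L. (cmod (L2_inner (indicator (\<Union>k<N. {real k..real k + \<delta>}))
          (tf_shift (of_int n + x, of_int l + w) g)))\<^sup>2)
        \<le> (\<Sum>n\<in>F. integral {0..\<delta>} (\<lambda>t. (cmod (\<phi> n t))\<^sup>2))"
        unfolding L2_inner_indicator_tf_shift[OF cont \<delta>(1,3)] \<phi>_def[symmetric]
        using \<delta>(3) by (intro sum_mono bessel_cis c\<phi> L) simp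
      also have "\<dots> = integral {0..\<delta>} (\<lambda>t. \<Sum>n\<in>F. (cmod (\<phi> n t))\<^sup>2)"
        by (rule integral_sum[symmetric, OF F])
           (intro integrable_continuous_interval continuous_intros c\<phi>)
      also have "\<dots> \<le> integral {0..\<delta>} (\<lambda>t. 2 * real N * \<epsilon> + B)"
        by (rule integral_le)
           (intro integrable_continuous_interval continuous_intros c\<phi> | rule bound)+
      also have "\<dots> = \<delta> * (2 * real N * \<epsilon> + B)"
        using \<delta> by simp
      finally show "(\<Sum>n\<in>F. \<Sum>l\<in>L. (cmod (L2_inner (indicator (\<Union>k<N. {real k..real k + \<delta>}))
          (tf_shift (of_int n + x, of_int l + w) g)))\<^sup>2) \<le> \<delta> * (2 * real N * \<epsilon> + B)" .
    qed (use r in simp)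
  qed
  then show ?thesis by blast
qed

lemma L2_norm_indicator_blocks:
  fixes N :: nat
  assumes \<delta>: "0 < \<delta>" "\<delta> < 1"
  defines "f \<equiv> (indicator (\<Union>k<N. {real k..real k + \<delta>}) :: real \<Rightarrow> complex)"
  shows "f \<in> L2" and "(L2_norm f)\<^sup>2 = real N * \<delta>"
proof -
  let ?U = "\<Union>k<N. {real k..real k + \<delta>}"
  have disj: "disjoint_family_on (\<lambda>k. {real k..real k + \<delta>}) {..<N}"
    using \<delta> by (auto simp: disjoint_family_on_def)
  have nf: "(cmod (f t))\<^sup>2 = indicator ?U t" for t
    by (simp add: f_def indicator_def)
  have "emeasure lborel ?U = (\<Sum>k<N. emeasure lborel {real k..real k + \<delta>})"
    by (rule sum_emeasure[symmetric, OF _ disj]) auto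
  also have "\<dots> = ennreal (real N * \<delta>)"
    using \<delta> by (simp add: ennreal_mult ennreal_of_nat_eq_real_of_nat)
  finally have U: "emeasure lborel ?U = ennreal (real N * \<delta>)" .
  have "integrable lborel (\<lambda>t. (cmod (f t))\<^sup>2)"
    unfolding nf by (rule integrable_real_indicator) (auto simp: U)
  then show "f \<in> L2"
    unfolding L2_def by (simp add: f_def borel_measurable_indicator)
  show "(L2_norm f)\<^sup>2 = real N * \<delta>"
    unfolding L2_norm_def nf using U \<delta> by (simp add: measure_def)
qed

text \<open>Trains of \<open>N\<close> intervals of length \<delta> have squared norm
  \<open>N * \<delta>\<close>. The lower frame bound asks for \<open>A * N * \<delta>\<close>, but
  the coefficients add up to at most \<open>\<delta> * (N * (A / 2) + Bs)\<close>, which is smaller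
  once \<open>N\<close> is large.\<close>

lemma not_gabor_frame_zak_zeros:
  assumes cont: "continuous_on UNIV g" and decay: "\<And>t. cmod (g t) \<le> C * exp (- \<bar>t\<bar>)"
    and I: "finite I" and zeros: "\<And>m. m \<in> I \<Longrightarrow> zak g (- fst (z m)) (snd (z m)) = 0"
  shows "\<not> gabor_frame g (\<Union>m\<in>I. (\<lambda>v. v + z m) ` int_span2 (1, 0) (0, 1))"
proof
  let ?\<Gamma> = "\<Union>m\<in>I. (\<lambda>v. v + z m) ` int_span2 (1, 0) (0, 1)"
  assume "gabor_frame g ?\<Gamma>"
  then obtain A where A: "0 < A" and frame: "\<And>f. f \<in> L2 \<Longrightarrow> ennreal (A * (L2_norm f)\<^sup>2)
      \<le> (\<Sum>\<^sub>\<infinity>\<gamma>\<in>?\<Gamma>. ennreal ((cmod (L2_inner f (tf_shift \<gamma> g)))\<^sup>2))"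
    unfolding gabor_frame_def by blast
  define U where "U N \<delta> = (indicator (\<Union>k<N. {real k..real k + \<delta>}) :: real \<Rightarrow> complex)" for N \<delta>
  define p where "p = (\<lambda>(m, n::int, l::int). (of_int n + fst (z m), of_int l + snd (z m)))"
  define Q where "Q N \<delta> \<gamma> = (cmod (L2_inner (U N \<delta>) (tf_shift \<gamma> g)))\<^sup>2" for N \<delta> \<gamma>
  \<comment> \<open>Makes \<open>2 * card I * \<epsilon>\<close> at most \<open>A / 2\<close>; the
    added 1 keeps the denominator positive for empty \<open>I\<close>.\<close>
  define \<epsilon> where "\<epsilon> = A / (4 * (real (card I) + 1))"
  have \<epsilon>: "\<epsilon> > 0" using A by (simp add: \<epsilon>_def)
  define K where "K m B \<delta>\<^sub>0 \<longleftrightarrow> (\<forall>\<delta> N F L. 0 < \<delta> \<longrightarrow> \<delta> \<le> \<delta>\<^sub>0 \<longrightarrow> \<delta> < 1 \<longrightarrow> finite F \<longrightarrow> finite L \<longrightarrow>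
      (\<Sum>n\<in>F. \<Sum>l\<in>L. Q N \<delta> (p (m, n, l))) \<le> \<delta> * (2 * real N * \<epsilon> + B))" for m B \<delta>\<^sub>0
  \<comment> \<open>Fixing \<epsilon> under the quantifier on \<open>B\<close> leaves plain
    existentials, from which \<open>B m\<close> and \<open>d m\<close> can be chosen as functions of
    \<open>m\<close>.\<close>
  have spec: "\<exists>B. P B \<epsilon>" if "\<exists>B. \<forall>\<epsilon>>0. P B \<epsilon>" for P :: "real \<Rightarrow> real \<Rightarrow> bool"
    using that \<epsilon> by blast
  have "\<exists>B. \<exists>\<delta>\<^sub>0>0. K m B \<delta>\<^sub>0" if "m \<in> I" for m
    unfolding K_def Q_def U_def p_def prod.case
    by (rule spec[OF gabor_block_bound[where g=g, OF cont decay zeros[OF that]]])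
  then obtain B d where K: "\<And>m. m \<in> I \<Longrightarrow> 0 < d m \<and> K m (B m) (d m)"
    by metis
  have Bd: "d m > 0" "\<And>\<delta> N F L. 0 < \<delta> \<Longrightarrow> \<delta> \<le> d m \<Longrightarrow> \<delta> < 1 \<Longrightarrow> finite F \<Longrightarrow> finite L \<Longrightarrow>
      (\<Sum>n\<in>F. \<Sum>l\<in>L. Q N \<delta> (p (m, n, l))) \<le> \<delta> * (2 * real N * \<epsilon> + B m)" if "m \<in> I" for m
    using K[OF that] by (simp_all add: K_def)
  \<comment> \<open>One width serves all translates; the entry \<open>1/2\<close> keeps it below 1
    and the set nonempty.\<close>
  define \<delta> where "\<delta> = Min (insert (1/2) (d ` I))"
  have \<delta>: "0 < \<delta>" "\<delta> < 1" "\<And>m. m \<in> I \<Longrightarrow> \<delta> \<le> d m"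
  proof -
    show "0 < \<delta>" using I Bd(1) by (auto simp: \<delta>_def)
    have "\<delta> \<le> 1/2" unfolding \<delta>_def using I by (intro Min_le) auto
    then show "\<delta> < 1" by simp
    show "\<delta> \<le> d m" if "m \<in> I" for m using I that by (auto simp: \<delta>_def)
  qed
  \<comment> \<open>The block estimate does not state the sign of its constants, hence the absolute
    value.\<close>
  define Bs where "Bs = \<bar>\<Sum>m\<in>I. B m\<bar>"
  obtain N :: nat where N: "Bs / (A / 2) < real N" using reals_Archimedean2 by blast
  have Npos: "0 < real N" using N A by (intro le_less_trans[OF _ N]) (simp add: Bs_def)
  have fin: "sum (Q N \<delta>) F \<le> \<delta> * (real N * (A / 2) + Bs)" if F: "finite F" "F \<subseteq> ?\<Gamma>" for F
  proof -
    have "?\<Gamma> \<subseteq> p ` (I \<times> UNIV \<times> UNIV)"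
    proof
      fix v assume "v \<in> ?\<Gamma>"
      then obtain m k l where m: "m \<in> I" and v: "v = (real_of_int k, real_of_int l) + z m"
        by (auto simp: int_span2_def)
      have "v = p (m, k, l)" by (simp add: v p_def prod_eq_iff)
      with m show "v \<in> p ` (I \<times> UNIV \<times> UNIV)" by blast
    qed
    with F have "F \<subseteq> p ` (I \<times> UNIV \<times> UNIV)" by (rule_tac order_trans)
    from finite_subset_image[OF F(1) this]
    obtain T where T: "T \<subseteq> I \<times> UNIV \<times> UNIV" "finite T" "F = p ` T" by blast
    \<comment> \<open>The projections of \<open>T\<close> span a finite box, over which the sum
      splits as the block estimate needs.\<close>
    define F1 where "F1 = (fst \<circ> snd) ` T"
    define F2 where "F2 = (snd \<circ> snd) ` T"
    have F12: "finite F1" "finite F2" using T by (auto simp: F1_def F2_def)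
    have TF: "T \<subseteq> I \<times> F1 \<times> F2"
    proof
      fix t assume t: "t \<in> T"
      then have "fst t \<in> I" using T(1) by auto
      moreover have "fst (snd t) \<in> F1" "snd (snd t) \<in> F2"
        unfolding F1_def F2_def by (rule image_eqI[OF _ t], simp)+
      ultimately show "t \<in> I \<times> F1 \<times> F2" by (simp add: mem_Times_iff)
    qed
    \<comment> \<open>Translates might overlap and \<open>p\<close> identify indices; repetitions
      only enlarge the right-hand side.\<close>
    have "sum (Q N \<delta>) F \<le> sum (Q N \<delta> \<circ> p) T"
      unfolding T(3) by (rule sum_image_le[OF T(2)]) (simp add: Q_def)
    also have "\<dots> \<le> sum (Q N \<delta> \<circ> p) (I \<times> F1 \<times> F2)"
      using I F12 by (intro sum_mono2 finite_cartesian_product TF) (simp_all add: Q_def)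
    also have "\<dots> = (\<Sum>m\<in>I. \<Sum>n\<in>F1. \<Sum>l\<in>F2. Q N \<delta> (p (m, n, l)))"
      by (simp only: sum.cartesian_product' o_apply)
    also have "\<dots> \<le> (\<Sum>m\<in>I. \<delta> * (2 * real N * \<epsilon> + B m))"
      using \<delta> F12 by (intro sum_mono Bd(2)) auto
    also have "\<dots> = \<delta> * (real N * (2 * real (card I) * \<epsilon>) + (\<Sum>m\<in>I. B m))"
      unfolding sum_distrib_left[symmetric] sum.distrib by (simp add: mult_ac)
    also have "\<dots> \<le> \<delta> * (real N * (A / 2) + Bs)"
    proof (intro mult_left_mono add_mono)
      show "2 * real (card I) * \<epsilon> \<le> A / 2"
        using A by (simp add: \<epsilon>_def field_simps)
    qed (use \<delta> in \<open>auto simp: Bs_def\<close>)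
    finally show ?thesis .
  qed
  have "ennreal (A * (real N * \<delta>)) \<le> (\<Sum>\<^sub>\<infinity>\<gamma>\<in>?\<Gamma>. ennreal (Q N \<delta> \<gamma>))"
    using frame[of "U N \<delta>"] L2_norm_indicator_blocks[OF \<delta>(1,2), of N] by (simp add: U_def Q_def)
  also have "\<dots> \<le> ennreal (\<delta> * (real N * (A / 2) + Bs))"
  proof (rule infsum_le_finite_sums)
    fix F assume "finite F" "F \<subseteq> ?\<Gamma>"
    from fin[OF this] show "(\<Sum>\<gamma>\<in>F. ennreal (Q N \<delta> \<gamma>)) \<le> ennreal (\<delta> * (real N * (A / 2) + Bs))"
      by (simp add: Q_def sum_ennreal ennreal_leI)
  qed (rule nonneg_summable_on_complete, simp)
  finally have "A * (real N * \<delta>) \<le> \<delta> * (real N * (A / 2) + Bs)"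
    using \<delta> A by (subst (asm) ennreal_le_iff) (auto simp: Bs_def)
  then have "A * real N \<le> real N * (A / 2) + Bs"
    using \<delta>(1) by (simp add: mult.left_commute[of A] mult.commute[of \<delta>] mult.commute[of A])
  moreover have "Bs < real N * (A / 2)"
    using N A by (simp add: pos_divide_less_eq)
  ultimately show False by (simp add: mult.commute)
qed

section \<open>Zeros of the Zak transform\<close>

text \<open>Majorant for the tails of the Zak series in the sign estimates: one geometric series for
  each half-line.\<close>

lemma geometric_int_tail:
  fixes q :: real
  assumes q: "0 \<le> q" "q < 1"
  shows "((\<lambda>j::int. q ^ nat \<bar>j\<bar>) has_sum (2 * (q / (1 - q)))) (- {0})"
proof -
  let ?f = "\<lambda>j::int. q ^ nat \<bar>j\<bar>"
  have geo: "((\<lambda>n. q ^ n) has_sum (q / (1 - q))) {1..}"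
    using q by (intro has_sum_geometric_from_1) simp
  have "(?f has_sum (q / (1 - q))) (int ` {1..})"
    using geo by (subst has_sum_reindex) (auto simp: o_def)
  moreover have "(?f has_sum (q / (1 - q))) ((\<lambda>n. - int n) ` {1..})"
    using geo by (subst has_sum_reindex) (auto simp: o_def inj_on_def)
  ultimately have "(?f has_sum (q / (1 - q) + q / (1 - q))) (int ` {1..} \<union> (\<lambda>n. - int n) ` {1..})"
    by (rule has_sum_Un_disjoint) auto
  moreover have "int ` {1..} \<union> (\<lambda>n. - int n) ` {1..} = - {0}"
  proof (intro equalityI subsetI)
    fix j :: int assume "j \<in> - {0}"
    then show "j \<in> int ` {1..} \<union> (\<lambda>n. - int n) ` {1..}"
      by (cases j rule: int_cases3) (auto simp: Suc_le_eq)
  qed auto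
  ultimately show ?thesis by simp
qed

section \<open>Symmetries of the Zak transform of an even window\<close>

text \<open>Substitute \<open>- j\<close> for \<open>j\<close>. Zeros of the transform thus come
  with their mirror images.\<close>

lemma zak_uminus:
  assumes "\<And>t. g (- t) = g t" "\<And>t. g t \<in> \<real>"
  shows "zak g (- u) w = cnj (zak g u w)"
proof -
  have "zak g (- u) w = (\<Sum>\<^sub>\<infinity>j::int. g (- u + of_int (- j)) * cis (2 * pi * w * of_int (- j)))"
    unfolding zak_def by (rule infsum_reindex_bij_witness[of _ uminus uminus]) auto
  also have "\<dots> = (\<Sum>\<^sub>\<infinity>j::int. cnj (g (u + of_int j) * cis (2 * pi * w * of_int j)))"
  proof (rule infsum_cong)
    fix j :: int
    have "g (- u + of_int (- j)) = cnj (g (u + of_int j))"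
      using assms(1)[of "u + of_int j"] assms(2)[of "u + of_int j"] by (simp add: Reals_cnj_iff)
    then show "g (- u + of_int (- j)) * cis (2 * pi * w * of_int (- j))
        = cnj (g (u + of_int j) * cis (2 * pi * w * of_int j))"
      by (simp add: cis_cnj)
  qed
  finally show ?thesis by (simp add: zak_def del: complex_cnj_mult)
qed

lemma cis_pi_of_int_reflect: "cis (pi * of_int (- 1 - j)) = - cis (pi * of_int j)"
proof -
  have "cis (pi * of_int (- 1 - j)) = cis pi * (cis (pi * of_int j) * cis (2 * pi * of_int (- 1 - j)))"
    unfolding cis_mult by (simp add: algebra_simps)
  also have "cis (2 * pi * of_int (- 1 - j)) = 1"
    by (rule cis_multiple_2pi) simp
  finally show ?thesis by simp
qed

text \<open>The reflection of \<open>j\<close> to \<open>- 1 - j\<close> negates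
  \<open>1/2 + j\<close> and changes the parity of \<open>j\<close>, so the sum equals its own
  negative.\<close>

lemma zak_half_half:
  assumes "\<And>t. g (- t) = g t"
  shows "zak g (1/2) (1/2) = 0"
proof -
  have "zak g (1/2) (1/2)
      = (\<Sum>\<^sub>\<infinity>j::int. g (1/2 + of_int (- 1 - j)) * cis (pi * of_int (- 1 - j)))"
    unfolding zak_def by (rule infsum_reindex_bij_witness[of _ "\<lambda>j. - 1 - j" "\<lambda>j. - 1 - j"]) auto
  also have "\<dots> = (\<Sum>\<^sub>\<infinity>j::int. - (g (1/2 + of_int j) * cis (pi * of_int j)))"
  proof (rule infsum_cong)
    fix j :: int
    have "1/2 + real_of_int (- 1 - j) = - (1/2 + real_of_int j)" by simp
    then show "g (1/2 + of_int (- 1 - j)) * cis (pi * of_int (- 1 - j))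
        = - (g (1/2 + of_int j) * cis (pi * of_int j))"
      by (simp only: cis_pi_of_int_reflect assms mult_minus_right)
  qed
  also have "\<dots> = - zak g (1/2) (1/2)"
    by (simp add: zak_def infsum_uminus)
  finally show ?thesis by simp
qed

section \<open>The dilated second Hermite function and its decay\<close>

text \<open>Real closed form of the window, for use in sign arguments;
  \<open>inv_dilation_hermite_fun_2\<close> identifies it, the powers of 2 in front
  cancelling.\<close>

definition h2dil :: "real \<Rightarrow> real" where
  "h2dil t = (8 * pi * t\<^sup>2 - 1) * exp (- 2 * pi * t\<^sup>2)"

lemma inv_dilation_hermite_fun_2:
  "inv (dilation (sqrt 2)) (hermite_fun 2) = (\<lambda>t. complex_of_real (h2dil t))"
proof -
  have s: "sqrt (sqrt 2) * 2 powr (- (1/4)) = 1"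
    by (simp flip: powr_half_sqrt add: powr_powr powr_minus)
  have "sqrt (sqrt 2) * (2 powr (- 1/4) * (- 1 + 4 * pi * (sqrt 2 * t)\<^sup>2) * exp (- pi * (sqrt 2 * t)\<^sup>2)) = h2dil t" for t
    using s by (simp add: h2dil_def power_mult_distrib mult.assoc[symmetric])
  then show ?thesis
    by (simp add: inv_dilation hermite_fun_2 flip: of_real_mult)
qed

lemma h2dil_uminus: "h2dil (- t) = h2dil t"
  by (simp add: h2dil_def)

lemma continuous_on_h2dil [continuous_intros]: "continuous_on A h2dil"
  unfolding h2dil_def by (intro continuous_intros)

text \<open>Half of the Gaussian exponent absorbs the polynomial factor; the other half is compared
  with \<open>exp (- \<bar>t\<bar>)\<close> through
  \<open>\<bar>t\<bar> \<le> 1 + t\<^sup>2\<close>, whose 1 yields \<open>exp 1\<close>.\<close>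

lemma abs_h2dil_le: "\<bar>h2dil t\<bar> \<le> 8 * exp 1 * exp (- \<bar>t\<bar>)"
proof -
  have "\<bar>8 * pi * t\<^sup>2 - 1\<bar> \<le> 8 * (1 + pi * t\<^sup>2)"
    using mult_nonneg_nonneg[OF pi_ge_zero zero_le_power2[of t]] by (simp add: abs_le_iff algebra_simps)
  also have "\<dots> \<le> 8 * exp (pi * t\<^sup>2)"
    by (intro mult_left_mono exp_ge_add_one_self) simp
  finally have "\<bar>h2dil t\<bar> \<le> 8 * exp (pi * t\<^sup>2) * exp (- 2 * pi * t\<^sup>2)"
    unfolding h2dil_def abs_mult abs_exp_cancel by (rule mult_right_mono) simp
  also have "\<dots> = 8 * exp (- (pi * t\<^sup>2))"
    by (simp add: mult.assoc flip: exp_add)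
  also have "\<dots> \<le> 8 * exp (1 + - \<bar>t\<bar>)"
  proof -
    have "\<bar>t\<bar> \<le> 1 + t\<^sup>2"
      using zero_le_power2[of "\<bar>t\<bar> - 1"] by (simp add: power2_diff)
    moreover have "t\<^sup>2 \<le> pi * t\<^sup>2"
      using pi_gt3 mult_right_mono[of 1 pi "t\<^sup>2"] by simp
    ultimately show ?thesis by simp
  qed
  finally show ?thesis by (simp only: exp_add mult.assoc)
qed

lemma exp_1_ge: "271/100 \<le> exp (1::real)"
  using abs_le_D2[OF e_approx_32] by simp

text \<open>For \<open>y = pi * t\<^sup>2\<close>, the bounds \<open>exp 1 * y \<le> exp y\<close>
  and \<open>8 \<le> 3 * exp 1\<close> give \<open>8 * y \<le> 3 * exp y\<close>. The small constant
  3 keeps the tails below the leading terms in the sign estimates.\<close>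

lemma abs_h2dil_le_gaussian:
  assumes "1 \<le> \<bar>t\<bar>"
  shows "\<bar>h2dil t\<bar> \<le> 3 * exp (- (pi * t\<^sup>2))"
proof -
  let ?y = "pi * t\<^sup>2"
  have "1 \<le> t\<^sup>2" using assms by (simp add: abs_le_square_iff[of 1 t, simplified])
  then have y: "1 \<le> ?y" using pi_gt3 mult_mono[of 1 pi 1 "t\<^sup>2"] by simp
  have "8 \<le> 3 * exp (1::real)"
    using exp_1_ge by simp
  then have "8 * ?y \<le> (3 * exp 1) * ?y" using y by (intro mult_right_mono) auto
  also have "\<dots> \<le> 3 * exp 1 * exp (?y - 1)"
    using exp_ge_add_one_self[of "?y - 1"] by (intro mult_left_mono) auto
  also have "\<dots> = 3 * exp ?y" by (simp add: exp_diff)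
  finally have "\<bar>8 * pi * t\<^sup>2 - 1\<bar> \<le> 3 * exp ?y" using y by simp
  then have "\<bar>h2dil t\<bar> \<le> 3 * exp ?y * exp (- 2 * pi * t\<^sup>2)"
    unfolding h2dil_def abs_mult abs_exp_cancel by (rule mult_right_mono) simp
  then show ?thesis by (simp add: mult.assoc flip: exp_add)
qed

abbreviation h2dilc :: "real \<Rightarrow> complex" where
  "h2dilc \<equiv> \<lambda>t. complex_of_real (h2dil t)"

lemma continuous_on_h2dilc: "continuous_on UNIV h2dilc"
  by (intro continuous_intros)

lemma cmod_h2dilc_le: "cmod (h2dilc t) \<le> 8 * exp 1 * exp (- \<bar>t\<bar>)"
  using abs_h2dil_le by simp

section \<open>Signs of the Zak transform on two lines\<close>

lemma has_sum_Re_zak_h2dil: "((\<lambda>j::int. h2dil (u + of_int j) * cos (2 * pi * w * of_int j)) has_sum Re (zak h2dilc u w)) UNIV"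
  using has_sum_Re[OF has_sum_zak[where g=h2dilc, OF cmod_h2dilc_le, of u w]] by simp

text \<open>On these two lines the characters take only the values 1 and -1, so the transform is
  real and a sign change yields a zero.\<close>

lemma zak_h2dil_eq_0_iff:
  assumes "w \<in> {0, 1/2}"
  shows "zak h2dilc u w = 0 \<longleftrightarrow> Re (zak h2dilc u w) = 0"
proof -
  have "sin (2 * pi * w * of_int j) = 0" for j :: int
  proof -
    have "2 * pi * w * of_int j = 0 \<or> 2 * pi * w * of_int j = pi * of_int j" for j
      using assms by auto
    then show ?thesis using sin_npi_int by (metis sin_zero)
  qed
  then have "((\<lambda>j. 0) has_sum Im (zak h2dilc u w)) (UNIV :: int set)"
    using has_sum_Im[OF has_sum_zak[where g=h2dilc, OF cmod_h2dilc_le, of u w]] by simp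
  then have "Im (zak h2dilc u w) = 0"
    using has_sum_0_simp has_sum_unique by blast
  then show ?thesis by (simp add: complex_eq_iff)
qed

text \<open>Outside \<open>J\<close> the Gaussian bound makes each term at most
  \<open>3 * q ^ nat \<bar>j\<bar>\<close>. The tail is enlarged to all nonzero \<open>j\<close>,
  and the two half-lines turn 3 into 6.\<close>

lemma Re_zak_h2dil_approx:
  assumes J: "finite J" "0 \<in> J" and q: "exp (- a) \<le> q" "q < 1"
    and big: "\<And>j. j \<notin> J \<Longrightarrow> 1 \<le> \<bar>u + of_int j\<bar>"
    and gauss: "\<And>j. j \<notin> J \<Longrightarrow> a * \<bar>of_int j\<bar> \<le> pi * (u + of_int j)\<^sup>2"
  shows "\<bar>Re (zak h2dilc u w) - (\<Sum>j\<in>J. h2dil (u + of_int j) * cos (2 * pi * w * of_int j))\<bar> \<le> 6 * (q / (1 - q))"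
proof -
  let ?f = "\<lambda>j::int. h2dil (u + of_int j) * cos (2 * pi * w * of_int j)"
  have q0: "0 \<le> q" using q(1) exp_ge_zero[of "- a"] by linarith
  note geo = geometric_int_tail[OF q0 q(2)]
  have sub: "- J \<subseteq> - {0}" using J by auto
  have summ: "(\<lambda>j::int. q ^ nat \<bar>j\<bar>) summable_on - J"
    by (rule summable_on_subset[OF has_sum_imp_summable[OF geo] sub])
  have "(?f has_sum (Re (zak h2dilc u w) - sum ?f J)) (UNIV - J)"
    using J(1) by (intro has_sum_Diff has_sum_Re_zak_h2dil) auto
  then have f: "(?f has_sum (Re (zak h2dilc u w) - sum ?f J)) (- J)"
    by (simp add: Compl_eq_Diff_UNIV)
  have "norm (Re (zak h2dilc u w) - sum ?f J) \<le> 3 * (\<Sum>\<^sub>\<infinity>j\<in>-J. q ^ nat \<bar>j\<bar>)"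
  proof (rule norm_infsum_le[OF f has_sum_cmult_right[OF has_sum_infsum[OF summ]]])
    fix j :: int assume "j \<in> - J"
    then have j: "j \<notin> J" by simp
    have "\<bar>?f j\<bar> \<le> \<bar>h2dil (u + of_int j)\<bar> * 1"
      unfolding abs_mult by (intro mult_left_mono) auto
    also have "\<dots> \<le> 3 * exp (- (pi * (u + of_int j)\<^sup>2))"
      using abs_h2dil_le_gaussian[OF big[OF j]] by simp
    also have "\<dots> \<le> 3 * exp (real (nat \<bar>j\<bar>) * - a)"
      using gauss[OF j] by (simp add: mult.commute)
    also have "\<dots> \<le> 3 * q ^ nat \<bar>j\<bar>"
      unfolding exp_of_nat_mult using q(1) by (simp add: power_mono)
    finally show "norm (?f j) \<le> 3 * q ^ nat \<bar>j\<bar>" by simp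
  qed
  also have "\<dots> \<le> 3 * (2 * (q / (1 - q)))"
    using has_sum_mono2[OF has_sum_infsum[OF summ] geo sub] q0 by simp
  finally show ?thesis by simp
qed

text \<open>The term at 0 is \<open>h2dil 0 = - 1\<close>, while \<open>pi > 3\<close> and
  \<open>exp 3 > 15\<close> bound the rest by \<open>6 / 14\<close>.\<close>

lemma Re_zak_h2dil_0_neg: "Re (zak h2dilc 0 w) < 0"
proof -
  have "\<bar>Re (zak h2dilc 0 w) - (\<Sum>j\<in>{0}. h2dil (0 + of_int j) * cos (2 * pi * w * of_int j))\<bar> \<le> 6 * ((1/15) / (1 - 1/15))"
  proof (rule Re_zak_h2dil_approx[where a=3])
    have "(271/100)^3 \<le> exp (1::real) ^ 3" using exp_1_ge by (intro power_mono) auto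
    also have "\<dots> = exp 3" by (simp flip: exp_of_nat_mult)
    finally show "exp (- 3) \<le> (1/15::real)" by (simp add: exp_minus field_simps power3_eq_cube)
    fix j :: int assume "j \<notin> {0}"
    then have j: "1 \<le> \<bar>real_of_int j\<bar>" by (simp flip: of_int_abs)
    then show "1 \<le> \<bar>0 + real_of_int j\<bar>" by simp
    have "3 * \<bar>real_of_int j\<bar> \<le> pi * \<bar>real_of_int j\<bar>" using pi_gt3 by (intro mult_right_mono) auto
    also have "\<dots> \<le> pi * \<bar>real_of_int j\<bar>\<^sup>2"
      using j mult_right_mono[OF j, of "\<bar>real_of_int j\<bar>"] by (intro mult_left_mono) (auto simp: power2_eq_square)
    finally show "3 * \<bar>real_of_int j\<bar> \<le> pi * (0 + real_of_int j)\<^sup>2" by simp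
  qed auto
  moreover have "h2dil 0 = - 1" by (simp add: h2dil_def)
  ultimately show ?thesis unfolding abs_le_iff by simp
qed

text \<open>All points \<open>1/2 + j\<close> lie beyond the two zeros of \<open>h2dil\<close>,
  because \<open>8 * pi / 4 > 1\<close>; for \<open>w = 0\<close> every term is therefore
  positive.\<close>

lemma Re_zak_h2dil_half_pos: "0 < Re (zak h2dilc (1/2) 0)"
proof -
  have pos: "0 < h2dil (1/2 + of_int j)" for j
  proof -
    have "0 \<le> j \<or> j \<le> - 1" by linarith
    then have "0 \<le> real_of_int j \<or> real_of_int j \<le> - 1" by linarith
    then have "1/2 \<le> \<bar>1/2 + real_of_int j\<bar>" by linarith
    from power_mono[OF this, of 2] have "1/4 \<le> (1/2 + real_of_int j)\<^sup>2"
      by (simp add: power2_eq_square)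
    then have "8 * pi * (1/4) \<le> 8 * pi * (1/2 + real_of_int j)\<^sup>2"
      by (intro mult_left_mono) auto
    then have "1 < 8 * pi * (1/2 + real_of_int j)\<^sup>2"
      using pi_gt3 by linarith
    then show ?thesis by (simp add: h2dil_def)
  qed
  have "(\<Sum>j\<in>{0::int}. h2dil (1/2 + of_int j) * cos (2 * pi * 0 * of_int j)) \<le> Re (zak h2dilc (1/2) 0)"
    by (rule finite_sum_le_has_sum[OF has_sum_Re_zak_h2dil]) (use pos in \<open>auto intro: less_imp_le\<close>)
  with pos[of 0] show ?thesis by simp
qed

text \<open>These are the terms \<open>j = 0\<close> and \<open>j = - 1\<close> of the transform at
  \<open>u = 2/5\<close>, \<open>w = 1/2\<close>. The margin \<open>13/100\<close> is set to beat
  the tail bound \<open>6/49\<close>.\<close>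

lemma h2dil_two_fifths: "13/100 < h2dil (2/5) - h2dil (3/5)"
proof -
  have p: "31415/10000 \<le> pi" "pi \<le> 31416/10000" using pi_approx by auto
  \<comment> \<open>The exponential in \<open>h2dil (3/5)\<close> is \<open>E * exp (- y)\<close>,
    so factoring out \<open>E\<close> leaves two exponentials to bound.\<close>
  define E where "E = exp (- (8 * pi / 25))"
  define y where "y = 2 * pi / 5"
  have "exp (8 * pi / 25) \<le> exp (1 + 6/1000)" using p by simp
  also have "\<dots> = exp 1 * exp (6/1000)" by (rule exp_add)
  also have "\<dots> \<le> 272/100 * (1 + 2 * (6/1000))"
    using e_less_272 by (intro mult_mono real_exp_bound_lemma) auto
  finally have "exp (8 * pi / 25) \<le> 276/100" by simp
  then have E: "100/276 \<le> E" by (simp add: E_def exp_minus field_simps)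
  have "y \<ge> 12566/10000" using p by (simp add: y_def)
  then have "3046/1000 \<le> 1 + y + y\<^sup>2 / 2"
    using power_mono[of "12566/10000" y 2] by (simp add: power2_eq_square)
  also have "\<dots> \<le> exp y" using p by (intro exp_lower_Taylor_quadratic) (simp add: y_def)
  finally have Y: "exp (- y) \<le> 1000/3046" by (simp add: exp_minus field_simps)
  have "(72 * pi / 25 - 1) * exp (- y) \<le> (72 * (31416/10000) / 25 - 1) * (1000/3046)"
    using p Y by (intro mult_mono) auto
  then have br: "36/100 \<le> (32 * pi / 25 - 1) - (72 * pi / 25 - 1) * exp (- y)"
    using p by simp
  have "exp (- (18 * pi / 25)) = E * exp (- y)"
    by (simp add: E_def y_def flip: exp_add)
  then have "h2dil (2/5) - h2dil (3/5) = E * ((32 * pi / 25 - 1) - (72 * pi / 25 - 1) * exp (- y))"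
    by (simp add: h2dil_def E_def power2_eq_square algebra_simps)
  also have "\<dots> \<ge> 100/276 * (36/100)"
    using E br by (intro mult_mono) auto
  finally show ?thesis by simp
qed

text \<open>The point \<open>2/5\<close> stops short of \<open>1/2\<close>, where the transform
  vanishes on this line by symmetry, so that the sign change gives a new zero.\<close>

lemma Re_zak_h2dil_two_fifths_pos: "0 < Re (zak h2dilc (2/5) (1/2))"
proof -
  have "\<bar>Re (zak h2dilc (2/5) (1/2)) - (\<Sum>j\<in>{0, -1}. h2dil (2/5 + of_int j) * cos (2 * pi * (1/2) * of_int j))\<bar>
      \<le> 6 * ((1/50) / (1 - 1/50))"
  proof (rule Re_zak_h2dil_approx[where a=4])
    have "(271/100)^4 \<le> exp (1::real) ^ 4" using exp_1_ge by (intro power_mono) auto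
    also have "\<dots> = exp 4" by (simp flip: exp_of_nat_mult)
    finally show "exp (- 4) \<le> (1/50::real)" by (simp add: exp_minus field_simps power4_eq_xxxx)
    fix j :: int assume j: "j \<notin> {0, -1}"
    then have "1 \<le> j \<or> j \<le> -2" by auto
    then have jr: "1 \<le> real_of_int j \<or> real_of_int j \<le> -2" by linarith
    then show "1 \<le> \<bar>2/5 + real_of_int j\<bar>" by auto
    \<comment> \<open>Equality at \<open>j = - 2\<close>, where
      \<open>(2/5 - 2)\<^sup>2 = 64/25\<close>, dictates the factor \<open>32/25\<close>; its
      product with \<open>pi\<close> still exceeds 4.\<close>
    have "32/25 * \<bar>real_of_int j\<bar> \<le> (2/5 + real_of_int j)\<^sup>2"
      using jr
    proof
      assume "1 \<le> real_of_int j"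
      then show ?thesis using zero_le_power2[of "real_of_int j - 6/25"]
        by (simp add: power2_eq_square algebra_simps)
    next
      assume "real_of_int j \<le> -2"
      \<comment> \<open>This product is exactly the difference of the two sides for negative
        \<open>j\<close>.\<close>
      then have "0 \<le> (- 2 - real_of_int j) * (- (2/25) - real_of_int j)"
        by (intro mult_nonneg_nonneg) auto
      with \<open>real_of_int j \<le> -2\<close> show ?thesis by (simp add: power2_eq_square algebra_simps)
    qed
    then have "pi * (32/25 * \<bar>real_of_int j\<bar>) \<le> pi * (2/5 + real_of_int j)\<^sup>2"
      by (intro mult_left_mono) auto
    moreover have "4 * \<bar>real_of_int j\<bar> \<le> pi * (32/25) * \<bar>real_of_int j\<bar>"
      using pi_approx by (intro mult_right_mono) auto
    ultimately show "4 * \<bar>real_of_int j\<bar> \<le> pi * (2/5 + real_of_int j)\<^sup>2" by linarith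
  qed auto
  then show ?thesis using h2dil_two_fifths h2dil_uminus[of "3/5"] unfolding abs_le_iff by simp
qed

text \<open>Intermediate value theorem between 0, where the transform is negative, and
  \<open>b\<close>. Strict signs at both ends keep the zero in the open interval, hence apart from
  its mirror image.\<close>

lemma zak_h2dil_zero_between:
  assumes w: "w \<in> {0, 1/2}" and b: "0 < b" "0 < Re (zak h2dilc b w)"
  obtains x where "0 < x" "x < b" "zak h2dilc x w = 0"
proof -
  have "continuous_on {0..b} (\<lambda>u. Re (zak h2dilc u w))"
    by (intro continuous_intros continuous_on_zak[where g=h2dilc, OF continuous_on_h2dilc cmod_h2dilc_le])
  then obtain x where x: "0 \<le> x" "x \<le> b" "Re (zak h2dilc x w) = 0"
    using IVT'[of "\<lambda>u. Re (zak h2dilc u w)" 0 0 b] b Re_zak_h2dil_0_neg[of w] by (auto intro: less_imp_le)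
  moreover have "x \<noteq> 0" "x \<noteq> b" using x(3) b(2) Re_zak_h2dil_0_neg[of w] by auto
  ultimately show ?thesis using that[of x] zak_h2dil_eq_0_iff[OF w, of x] by simp
qed

section \<open>Five zeros modulo the integer lattice\<close>

lemma not_in_int_span2_unit:
  assumes "v \<noteq> 0" "\<bar>fst v\<bar> < 1" "\<bar>snd v\<bar> < 1"
  shows "v \<notin> int_span2 (1, 0) (0, 1)"
proof
  assume "v \<in> int_span2 (1, 0) (0, 1)"
  then obtain k l :: int where "v = (of_int k, of_int l)" by (auto simp: int_span2_def)
  with assms show False by (simp add: zero_prod_def flip: of_int_abs)
qed

theorem mainTheorem5:
  "\<exists>\<Gamma> \<Lambda> M z. periodic_structure \<Gamma> \<Lambda> M z \<and> real M / covolume \<Lambda> = 5 \<and>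
     \<not> gabor_frame (inv (dilation (sqrt 2)) (hermite_fun 2)) \<Gamma>"
proof -
  obtain x\<^sub>0 where x0: "0 < x\<^sub>0" "x\<^sub>0 < 1/2" "zak h2dilc x\<^sub>0 0 = 0"
    using zak_h2dil_zero_between[OF _ _ Re_zak_h2dil_half_pos] by auto
  obtain x\<^sub>1 where x1: "0 < x\<^sub>1" "x\<^sub>1 < 2/5" "zak h2dilc x\<^sub>1 (1/2) = 0"
    using zak_h2dil_zero_between[OF _ _ Re_zak_h2dil_two_fifths_pos] by auto
  have sym: "zak h2dilc (- u) w = cnj (zak h2dilc u w)" for u w
    by (rule zak_uminus) (simp_all add: h2dil_uminus)
  \<comment> \<open>The shifts are numbered from 1, so the entry at index 0 is a dummy.\<close>
  define zs :: "(real \<times> real) list" where "zs = [(0, 0), (1/2, 1/2), (x\<^sub>1, 1/2), (- x\<^sub>1, 1/2), (x\<^sub>0, 0), (- x\<^sub>0, 0)]"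
  define z where "z m = zs ! m" for m
  have I: "{1..5} = {1, 2, 3, 4, 5 :: nat}"
    by (simp add: numeral_eq_Suc atLeastAtMostSuc_conv insert_commute)
  let ?\<Lambda> = "int_span2 (1, 0) (0, 1)"
  let ?\<Gamma> = "\<Union>m\<in>{1..5}. (\<lambda>v. v + z m) ` ?\<Lambda>"
  have det: "det2 (1, 0) (0, 1) = 1" by (simp add: det2_def)
  \<comment> \<open>The symmetry \<open>sym\<close> makes the sign of \<open>- fst (z m)\<close>
    harmless and covers the mirrored points.\<close>
  have "zak h2dilc (- fst (z m)) (snd (z m)) = 0" if "m \<in> {1..5}" for m
    using that unfolding I
    by (auto simp: z_def zs_def sym x0 x1 zak_half_half h2dil_uminus)
  then have "\<not> gabor_frame h2dilc ?\<Gamma>"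
    by (intro not_gabor_frame_zak_zeros[where g=h2dilc, OF continuous_on_h2dilc cmod_h2dilc_le]) auto
  moreover have "periodic_structure ?\<Gamma> ?\<Lambda> 5 z"
    unfolding periodic_structure_def
  proof (intro conjI ballI impI)
    show "full_rank_lattice ?\<Lambda>"
      unfolding full_rank_lattice_def using det by (metis zero_neq_one)
    fix m n :: nat assume mn: "m \<in> {1..5}" "n \<in> {1..5}" "m \<noteq> n"
    \<comment> \<open>Positivity separates each zero from its mirror image, and
      \<open>x\<^sub>1 < 2/5\<close> separates \<open>x\<^sub>1\<close> from
      \<open>1/2\<close>.\<close>
    have "distinct zs" "length zs = 6" using x0 x1 by (simp_all add: zs_def)
    then have "z m \<noteq> z n"
      using mn by (simp add: z_def nth_eq_iff_index_eq)
    \<comment> \<open>First coordinates in a half-open interval of length 1 and second ones in an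
      interval of length \<open>1/2\<close> leave no room for a nonzero integer difference.\<close>
    moreover have "- 1/2 < fst (z k) \<and> fst (z k) \<le> 1/2 \<and> 0 \<le> snd (z k) \<and> snd (z k) \<le> 1/2"
      if "k \<in> {1..5}" for k
      using that x0 x1 unfolding I by (auto simp: z_def zs_def)
    from this[OF mn(1)] this[OF mn(2)] have "\<bar>fst (z m - z n)\<bar> < 1" "\<bar>snd (z m - z n)\<bar> < 1"
      unfolding fst_diff snd_diff by linarith+
    ultimately show "z m - z n \<notin> ?\<Lambda>"
      by (intro not_in_int_span2_unit) simp_all
  qed auto
  moreover have "covolume ?\<Lambda> = 1"
    using covolume_int_span2[of "(1, 0)" "(0, 1)"] det by simp
  ultimately show ?thesis
    unfolding inv_dilation_hermite_fun_2
    by (intro exI[of _ ?\<Gamma>] exI[of _ ?\<Lambda>] exI[of _ 5] exI[of _ z]) simp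
qed

end
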